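(* Let $(A,\tau_\lambda,\alpha,\beta)$ be a BiHom-associative conformal algebra with product $p_\lambda q$, let $\theta\in\mathbb{C}$, and let $R:A\to A$ be a Rota-Baxter operator of weight $\theta$ that commutes with $\alpha$ and $\beta$. Define $p\prec_\lambda q=p_\lambda R(q)$, $p\succ_\lambda q=R(p)_\lambda q$ and $p\cdot_\lambda q=\theta(p_\lambda q)$ for all $p,q\in A$. Then $(A,\prec_\lambda,\succ_\lambda,\cdot_\lambda,\alpha,\beta)$ is a BiHom-tridendriform conformal algebra.
   Context: All vector spaces, linear maps and tensor products are over $\mathbb{C}$; $\lambda,\mu$ are formal variables. For a $\mathbb{C}[\partial]$-module $A$ put $A[\lambda]=\mathbb{C}[\lambda]\otimes A$. A $\mathbb{C}$-bilinear map $A\otimes A\to A[\lambda]$, $p\otimes q\mapsto p\circ_\lambda q$, is conformal sesquilinear if $(\partial p)\circ_\lambda q=-\lambda(p\circ_\lambda q)$ and $p\circ_\lambda(\partial q)=(\partial+\lambda)(p\circ_\lambda q)$. Linear maps and products are extended coefficientwise to polynomials in $\lambda,\mu$; e.g. if $p\circ_\lambda q=\sum_i\lambda^i a_i$ then $(p\circ_\lambda q)\circ_{\lambda+\mu}r=\sum_i\lambda^i(a_i\circ_{\lambda+\mu}r)$. A map $\alpha$ is multiplicative for $\circ_\lambda$ if $\alpha(p\circ_\lambda q)=\alpha(p)\circ_\lambda\alpha(q)$. A BiHom-associative conformal algebra $(A,\tau_\lambda,\alpha,\beta)$ is a $\mathbb{C}[\partial]$-module $A$ with a conformal sesquilinear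 map $\tau_\lambda:A\otimes A\to A[\lambda]$, $p\otimes q\mapsto p_\lambda q$, and commuting $\mathbb{C}$-linear maps $\alpha,\beta:A\to A$ commuting with $\partial$ and multiplicative, such that $\alpha(p)_\lambda(q_\mu r)=(p_\lambda q)_{\lambda+\mu}\beta(r)$. A Rota-Baxter operator of weight $\theta$ on $(A,\tau_\lambda)$ is a homomorphism of $\mathbb{C}[\partial]$-modules $R:A\to A$ with $R(p)_\lambda R(q)=R(R(p)_\lambda q+p_\lambda R(q)+\theta(p_\lambda q))$ for all $p,q\in A$. A BiHom-tridendriform conformal algebra $(A,\prec_\lambda,\succ_\lambda,\cdot_\lambda,\alpha,\beta)$ is a $\mathbb{C}[\partial]$-module $A$ with three conformal sesquilinear maps $\prec_\lambda,\succ_\lambda,\cdot_\lambda:A\otimes A\to A[\lambda]$ and commuting $\mathbb{C}$-linear maps $\alpha,\beta:A\to A$ commuting with $\partial$ and multiplicative for all three products, such that for all $p,q,r\in A$: $(p\prec_\lambda q)\prec_{\lambda+\mu}\beta(r)=\alpha(p)\prec_\lambda(q\prec_\mu r+q\succ_\mu r+q\cdot_\mu r)$; $(p\succ_\lambda q)\prec_{\lambda+\mu}\beta(r)=\alpha(p)\succ_\lambda(q\prec_\mu r)$; $\alpha(p)\succ_\lambda(q\succ_\mu r)=(p\prec_\lambda q+p\succ_\lambda q+p\cdot_\lambda q)\succ_{\lambda+\mu}\beta(r)$; $\alpha(p)\cdot_\lambda(q\succ_\mu r)=(p\prec_\lambda q)\cdot_{\lambda+\mu}\beta(r)$; $\alpha(p)\succ_\lambda(q\cdot_\mu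 r)=(p\succ_\lambda q)\cdot_{\lambda+\mu}\beta(r)$; $\alpha(p)\cdot_\lambda(q\prec_\mu r)=(p\cdot_\lambda q)\prec_{\lambda+\mu}\beta(r)$; $\alpha(p)\cdot_\lambda(q\cdot_\mu r)=(p\cdot_\lambda q)\cdot_{\lambda+\mu}\beta(r)$. *)

theory Defs
  imports "HOL-Computational_Algebra.Polynomial"
begin

text \<open>
  A \<open>\<complex>[\<partial>]\<close>-module is a library module \<open>act\<close> over the ring \<^typ>\<open>complex poly\<close>, whose variable
  plays the role of \<open>\<partial>\<close>.  The carrier \<open>A\<close> is a type \<open>'a\<close>, and \<open>A[\<lambda>]\<close> is the type \<open>'a poly\<close>.
  Multiplication by \<open>\<lambda>\<close> is \<open>pCons 0\<close>, and the coefficientwise extension of a linear map \<open>h\<close> to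
  \<open>A[\<lambda>]\<close> is \<open>map_poly h\<close> (every such \<open>h\<close> used below maps 0 to 0).
\<close>

definition deriv_of :: "(complex poly \<Rightarrow> 'a \<Rightarrow> 'a) \<Rightarrow> 'a \<Rightarrow> 'a" where
  "deriv_of act = act [:0, 1:]"

definition cscale :: "(complex poly \<Rightarrow> 'a \<Rightarrow> 'a) \<Rightarrow> complex \<Rightarrow> 'a \<Rightarrow> 'a" where
  "cscale act c = act [:c:]"

definition poly_cscale ::
    "(complex poly \<Rightarrow> 'a::zero \<Rightarrow> 'a) \<Rightarrow> complex \<Rightarrow> 'a poly \<Rightarrow> 'a poly" where
  "poly_cscale act c = map_poly (cscale act c)"

definition conformal_sesquilinear ::
    "(complex poly \<Rightarrow> 'a::ab_group_add \<Rightarrow> 'a) \<Rightarrow> ('a \<Rightarrow> 'a \<Rightarrow> 'a poly) \<Rightarrow> bool" where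
  "conformal_sesquilinear act f \<longleftrightarrow>
    (\<forall>q. Vector_Spaces.linear (cscale act) (poly_cscale act) (\<lambda>p. f p q)) \<and>
    (\<forall>p. Vector_Spaces.linear (cscale act) (poly_cscale act) (\<lambda>q. f p q)) \<and>
    (\<forall>p q. f (deriv_of act p) q = - pCons 0 (f p q)) \<and>
    (\<forall>p q. f p (deriv_of act q) = map_poly (deriv_of act) (f p q) + pCons 0 (f p q))"

definition multiplicative :: "('a::zero \<Rightarrow> 'a \<Rightarrow> 'a poly) \<Rightarrow> ('a \<Rightarrow> 'a) \<Rightarrow> bool" where
  "multiplicative f \<alpha> \<longleftrightarrow> (\<forall>p q. map_poly \<alpha> (f p q) = f (\<alpha> p) (\<alpha> q))"

text \<open>
  \<open>A[\<lambda>,\<mu>]\<close> is the type \<open>'a poly poly\<close>, with \<open>\<mu>\<close> the outer variable (multiplication by \<open>\<mu>\<close> is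
  \<open>pCons 0\<close>) and \<open>\<lambda>\<close> the inner one (multiplication by \<open>\<lambda>\<close> is \<open>map_poly (pCons 0)\<close>).
\<close>

definition times_lambda :: "'a::zero poly poly \<Rightarrow> 'a poly poly" where
  "times_lambda = map_poly (pCons 0)"

definition times_lambda_plus_mu :: "'a::comm_monoid_add poly poly \<Rightarrow> 'a poly poly" where
  "times_lambda_plus_mu Q = times_lambda Q + pCons 0 Q"

text \<open>\<open>P(\<nu>) = \<Sum>\<^sub>i \<nu>\<^sup>i a\<^sub>i\<close> is sent to \<open>P(\<lambda>+\<mu>) = \<Sum>\<^sub>i (\<lambda>+\<mu>)\<^sup>i a\<^sub>i\<close>.\<close>

definition at_lambda_plus_mu :: "'a::comm_monoid_add poly \<Rightarrow> 'a poly poly" where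
  "at_lambda_plus_mu P = (\<Sum>i\<le>degree P. (times_lambda_plus_mu ^^ i) [:[:coeff P i:]:])"

text \<open>For \<open>P = \<Sum>\<^sub>i \<lambda>\<^sup>i a\<^sub>i\<close>, this is \<open>P \<circ>\<^bsub>\<lambda>+\<mu>\<^esub> r = \<Sum>\<^sub>i \<lambda>\<^sup>i (a\<^sub>i \<circ>\<^bsub>\<lambda>+\<mu>\<^esub> r)\<close>.\<close>

definition prod_left ::
    "('a::comm_monoid_add \<Rightarrow> 'a \<Rightarrow> 'a poly) \<Rightarrow> 'a poly \<Rightarrow> 'a \<Rightarrow> 'a poly poly" where
  "prod_left f P r =
    (\<Sum>i\<le>degree P. (times_lambda ^^ i) (at_lambda_plus_mu (f (coeff P i) r)))"

text \<open>For \<open>Q = \<Sum>\<^sub>j \<mu>\<^sup>j b\<^sub>j\<close>, this is \<open>p \<circ>\<^sub>\<lambda> Q = \<Sum>\<^sub>j \<mu>\<^sup>j (p \<circ>\<^sub>\<lambda> b\<^sub>j)\<close>.\<close>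

definition prod_right ::
    "('a::zero \<Rightarrow> 'a \<Rightarrow> 'a poly) \<Rightarrow> 'a \<Rightarrow> 'a poly \<Rightarrow> 'a poly poly" where
  "prod_right f p Q = map_poly (f p) Q"

locale bihom_module = module act
  for act :: "complex poly \<Rightarrow> 'a::ab_group_add \<Rightarrow> 'a" +
  fixes \<alpha> \<beta> :: "'a \<Rightarrow> 'a"
  assumes linear_alpha: "Vector_Spaces.linear (cscale act) (cscale act) \<alpha>"
    and linear_beta: "Vector_Spaces.linear (cscale act) (cscale act) \<beta>"
    and alpha_beta: "\<alpha> (\<beta> p) = \<beta> (\<alpha> p)"
    and alpha_deriv: "\<alpha> (deriv_of act p) = deriv_of act (\<alpha> p)"
    and beta_deriv: "\<beta> (deriv_of act p) = deriv_of act (\<beta> p)"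

locale bihom_assoc_conformal_algebra = bihom_module act \<alpha> \<beta>
  for act :: "complex poly \<Rightarrow> 'a::ab_group_add \<Rightarrow> 'a"
    and \<tau> :: "'a \<Rightarrow> 'a \<Rightarrow> 'a poly"
    and \<alpha> \<beta> :: "'a \<Rightarrow> 'a" +
  assumes sesquilinear: "conformal_sesquilinear act \<tau>"
    and mult_alpha: "multiplicative \<tau> \<alpha>"
    and mult_beta: "multiplicative \<tau> \<beta>"
    and bihom_assoc: "prod_right \<tau> (\<alpha> p) (\<tau> q r) = prod_left \<tau> (\<tau> p q) (\<beta> r)"

definition rota_baxter_operator ::
    "(complex poly \<Rightarrow> 'a::ab_group_add \<Rightarrow> 'a) \<Rightarrow> ('a \<Rightarrow> 'a \<Rightarrow> 'a poly) \<Rightarrow> complex \<Rightarrow> ('a \<Rightarrow> 'a) \<Rightarrow> bool"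
  where
  "rota_baxter_operator act \<tau> \<theta> R \<longleftrightarrow>
    module_hom act act R \<and>
    (\<forall>p q. \<tau> (R p) (R q) =
      map_poly R (\<tau> (R p) q + \<tau> p (R q) + poly_cscale act \<theta> (\<tau> p q)))"

locale bihom_tridendriform_conformal_algebra = bihom_module act \<alpha> \<beta>
  for act :: "complex poly \<Rightarrow> 'a::ab_group_add \<Rightarrow> 'a"
    and L G M :: "'a \<Rightarrow> 'a \<Rightarrow> 'a poly"  \<comment> \<open>\<open>\<prec>\<^sub>\<lambda>\<close>, \<open>\<succ>\<^sub>\<lambda>\<close> and \<open>\<cdot>\<^sub>\<lambda>\<close>\<close>
    and \<alpha> \<beta> :: "'a \<Rightarrow> 'a" +
  assumes sesquilinear_L: "conformal_sesquilinear act L"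
    and sesquilinear_G: "conformal_sesquilinear act G"
    and sesquilinear_M: "conformal_sesquilinear act M"
    and mult_alpha_L: "multiplicative L \<alpha>"
    and mult_alpha_G: "multiplicative G \<alpha>"
    and mult_alpha_M: "multiplicative M \<alpha>"
    and mult_beta_L: "multiplicative L \<beta>"
    and mult_beta_G: "multiplicative G \<beta>"
    and mult_beta_M: "multiplicative M \<beta>"
    and L_L: "prod_left L (L p q) (\<beta> r) = prod_right L (\<alpha> p) (L q r + G q r + M q r)"
    and G_L: "prod_left L (G p q) (\<beta> r) = prod_right G (\<alpha> p) (L q r)"
    and G_G: "prod_right G (\<alpha> p) (G q r) = prod_left G (L p q + G p q + M p q) (\<beta> r)"
    and M_G: "prod_right M (\<alpha> p) (G q r) = prod_left M (L p q) (\<beta> r)"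
    and G_M: "prod_right G (\<alpha> p) (M q r) = prod_left M (G p q) (\<beta> r)"
    and M_L: "prod_right M (\<alpha> p) (L q r) = prod_left L (M p q) (\<beta> r)"
    and M_M: "prod_right M (\<alpha> p) (M q r) = prod_left M (M p q) (\<beta> r)"

end

theory Submission
  imports Defs
begin

text \<open>
  The seven tridendriform identities are the associativity law
  \<open>\<alpha>(p)\<^sub>\<lambda>(q\<^sub>\<mu> r) = (p\<^sub>\<lambda> q)\<^bsub>\<lambda>+\<mu>\<^esub> \<beta>(r)\<close> with \<open>R\<close> put in front of at most two of the three arguments,
  one identity for each choice of a proper subset of the arguments; \<open>R\<close> commutes with \<open>\<alpha>\<close> and \<open>\<beta>\<close>,
  so \<open>\<alpha>(R(p))\<close> and \<open>\<beta>(R(r))\<close> are the twisted arguments required.  If \<open>R\<close> is on two neighbouring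
  arguments, their product \<open>R(p)\<^sub>\<lambda> R(q)\<close> is \<open>R\<close> applied to
  \<open>p \<prec>\<^sub>\<lambda> q + p \<succ>\<^sub>\<lambda> q + p \<cdot>\<^sub>\<lambda> q\<close> by the Rota-Baxter relation, which gives the two identities with a
  sum of three products.  If \<open>R\<close> is on fewer than two arguments, the identity is the law multiplied
  by \<open>\<theta>\<close> (one \<open>R\<close>) or \<open>\<theta>\<^sup>2\<close> (no \<open>R\<close>).

  Sesquilinearity and multiplicativity pass to the new products because \<open>R\<close> and the scalar \<open>\<theta>\<close> are
  \<open>\<complex>[\<partial>]\<close>-linear and commute with \<open>\<alpha>\<close> and \<open>\<beta>\<close>.  The technical part is to move linear maps through the iterated products \<open>p \<circ>\<^sub>\<lambda> Q\<close> and
  \<open>P \<circ>\<^bsub>\<lambda>+\<mu>\<^esub> r\<close> with a polynomial argument.  A map applied to the coefficients of \<open>P\<close> can be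
  absorbed into the product (\<open>prod_left_map_poly\<close>), and an additive map applied to the values of
  the product comes out coefficientwise (\<open>prod_left_map_poly_value\<close>), because the substitution
  \<open>\<nu> \<mapsto> \<lambda>+\<mu>\<close> is natural in the coefficients (\<open>at_lambda_plus_mu_map_poly\<close>).
\<close>

section \<open>Coefficientwise maps and the substitution of \<open>\<lambda>+\<mu>\<close>\<close>

lemma map_poly_add:
  fixes h :: "'a::comm_monoid_add \<Rightarrow> 'b::comm_monoid_add"
  assumes "h 0 = 0" and "\<And>x y. h (x + y) = h x + h y"
  shows "map_poly h (P + Q) = map_poly h P + map_poly h Q"
  by (rule poly_eqI) (simp add: coeff_map_poly assms)

lemma map_poly_sum:
  fixes h :: "'a::comm_monoid_add \<Rightarrow> 'b::comm_monoid_add"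
  assumes "h 0 = 0" and "\<And>x y. h (x + y) = h x + h y"
  shows "map_poly h (sum F I) = (\<Sum>i\<in>I. map_poly h (F i))"
  by (induction I rule: infinite_finite_induct) (simp_all add: map_poly_add[OF assms])

lemma map_poly_pCons_0:
  "h 0 = 0 \<Longrightarrow> map_poly h (pCons 0 P) = pCons 0 (map_poly h P)"
  by (simp add: map_poly_pCons)

lemma map_poly_times_lambda:
  assumes "h 0 = 0"
  shows "map_poly (map_poly h) (times_lambda Q) = times_lambda (map_poly (map_poly h) Q)"
  by (rule poly_eqI) (simp add: times_lambda_def coeff_map_poly map_poly_pCons assms)

lemma map_poly_times_lambda_plus_mu:
  assumes "h 0 = 0" and "\<And>x y. h (x + y) = h x + h y"
  shows "map_poly (map_poly h) (times_lambda_plus_mu Q) =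
    times_lambda_plus_mu (map_poly (map_poly h) Q)"
  by (simp add: times_lambda_plus_mu_def map_poly_add map_poly_times_lambda map_poly_pCons_0 assms)

lemma funpow_commute:
  assumes "\<And>x. h (t x) = u (h x)"
  shows "h ((t ^^ n) x) = (u ^^ n) (h x)"
  by (induction n) (simp_all add: assms)

lemma funpow_times_lambda_0 [simp]: "(times_lambda ^^ n) 0 = 0"
  by (induction n) (simp_all add: times_lambda_def)

lemma funpow_times_lambda_plus_mu_0 [simp]: "(times_lambda_plus_mu ^^ n) 0 = 0"
  by (induction n) (simp_all add: times_lambda_plus_mu_def times_lambda_def)

lemma at_lambda_plus_mu_0 [simp]: "at_lambda_plus_mu 0 = 0"
  by (simp add: at_lambda_plus_mu_def)

lemma degree_map_poly_le:
  assumes "h 0 = 0"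
  shows "degree (map_poly h P) \<le> degree P"
  by (rule degree_le) (simp add: coeff_map_poly coeff_eq_0 assms)

text \<open>A coefficientwise map may lower the degree, so the defining sums must be
  compared over an index range that is common to both sides.\<close>

lemma at_lambda_plus_mu_upto:
  assumes "degree P \<le> n"
  shows "at_lambda_plus_mu P = (\<Sum>i\<le>n. (times_lambda_plus_mu ^^ i) [:[:coeff P i:]:])"
  unfolding at_lambda_plus_mu_def
  by (rule sum.mono_neutral_left) (use assms in \<open>auto simp: coeff_eq_0\<close>)

lemma prod_left_upto:
  assumes "degree P \<le> n" and "f 0 r = 0"
  shows "prod_left f P r =
    (\<Sum>i\<le>n. (times_lambda ^^ i) (at_lambda_plus_mu (f (coeff P i) r)))"
  unfolding prod_left_def
  by (rule sum.mono_neutral_left) (use assms in \<open>auto simp: coeff_eq_0\<close>)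

text \<open>Multiplication by \<open>\<lambda>+\<mu>\<close> commutes with any additive map of the coefficients, hence so does the
  expansion of a power \<open>(\<lambda>+\<mu>)\<^sup>i\<close>.\<close>

lemma at_lambda_plus_mu_map_poly:
  assumes h: "h 0 = 0" "\<And>x y. h (x + y) = h x + h y"
  shows "at_lambda_plus_mu (map_poly h P) = map_poly (map_poly h) (at_lambda_plus_mu P)"
proof -
  have "at_lambda_plus_mu (map_poly h P) =
      (\<Sum>i\<le>degree P. (times_lambda_plus_mu ^^ i) [:[:h (coeff P i):]:])"
    by (simp add: at_lambda_plus_mu_upto[OF degree_map_poly_le[where h = h, OF h(1)]] coeff_map_poly h)
  also have "\<dots> = (\<Sum>i\<le>degree P.
      map_poly (map_poly h) ((times_lambda_plus_mu ^^ i) [:[:coeff P i:]:]))"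
    by (simp add: funpow_commute[of "map_poly (map_poly h)" times_lambda_plus_mu times_lambda_plus_mu]
        map_poly_times_lambda_plus_mu map_poly_pCons h)
  also have "\<dots> = map_poly (map_poly h) (at_lambda_plus_mu P)"
    by (simp add: at_lambda_plus_mu_def map_poly_sum map_poly_add h)
  finally show ?thesis .
qed

section \<open>Moving linear maps through iterated products\<close>

lemma prod_left_map_poly:
  assumes "h 0 = 0" and "f 0 r = 0"
  shows "prod_left f (map_poly h P) r = prod_left (\<lambda>p q. f (h p) q) P r"
  by (simp add: prod_left_upto[OF degree_map_poly_le[where h = h, OF assms(1)]] coeff_map_poly assms)
     (simp add: prod_left_def)

lemma prod_left_map_poly_value:
  assumes h: "h 0 = 0" "\<And>x y. h (x + y) = h x + h y"
  shows "prod_left (\<lambda>p q. map_poly h (f p q)) P r = map_poly (map_poly h) (prod_left f P r)"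
  by (simp add: prod_left_def at_lambda_plus_mu_map_poly map_poly_sum map_poly_times_lambda map_poly_add h
      funpow_commute[of "map_poly (map_poly h)" times_lambda times_lambda])

lemma prod_right_map_poly:
  assumes "h 0 = 0" and "f p 0 = 0"
  shows "prod_right f p (map_poly h Q) = prod_right (\<lambda>p q. f p (h q)) p Q"
  by (rule poly_eqI) (simp add: prod_right_def coeff_map_poly assms)

lemma prod_right_map_poly_value:
  assumes "h 0 = 0" and "f p 0 = 0"
  shows "prod_right (\<lambda>p q. map_poly h (f p q)) p Q = map_poly (map_poly h) (prod_right f p Q)"
  by (rule poly_eqI) (simp add: prod_right_def coeff_map_poly assms)

section \<open>Sesquilinear products derived from a given one\<close>

lemma linear_zero: "Vector_Spaces.linear s1 s2 h \<Longrightarrow> h 0 = 0"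
  by (rule Vector_Spaces.linear.axioms(3)[THEN module_hom.zero])

lemma vector_space_cscale: "module act \<Longrightarrow> vector_space (cscale act)"
  by unfold_locales
     (simp_all add: cscale_def module.scale_right_distrib module.scale_left_distrib[symmetric]
        module.scale_scale module.scale_one mult.commute flip: one_pCons)

text \<open>\<open>\<complex>\<close> is central in \<open>\<complex>[\<partial>]\<close>, so scalars commute with \<open>\<partial>\<close>.\<close>

lemma cscale_deriv_of:
  "module act \<Longrightarrow> cscale act c (deriv_of act x) = deriv_of act (cscale act c x)"
  unfolding cscale_def deriv_of_def by (rule module.scale_left_commute)

lemma cscale_zero: "module act \<Longrightarrow> cscale act c 0 = 0"
  by (simp add: cscale_def module.scale_zero_right)

lemma cscale_add: "module act \<Longrightarrow> cscale act c (x + y) = cscale act c x + cscale act c y"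
  by (simp add: cscale_def module.scale_right_distrib)

lemma deriv_of_zero: "module act \<Longrightarrow> deriv_of act 0 = 0"
  by (simp add: deriv_of_def module.scale_zero_right)

lemma module_hom_imp_linear_cscale:
  assumes "module_hom act act R"
  shows "Vector_Spaces.linear (cscale act) (cscale act) R"
  using assms
  by (auto simp: Vector_Spaces.linear_iff module_hom_iff vector_space_cscale)
     (auto simp: cscale_def)

lemma conformal_sesquilinear_zero:
  assumes "conformal_sesquilinear act f"
  shows "f 0 q = 0" and "f p 0 = 0"
  using assms by (auto simp: conformal_sesquilinear_def dest: linear_zero)

lemma conformal_sesquilinear_precompose_left:
  assumes f: "conformal_sesquilinear act f" and R: "module_hom act act R"
  shows "conformal_sesquilinear act (\<lambda>p q. f (R p) q)"
proof -
  have "R (deriv_of act p) = deriv_of act (R p)" for p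
    unfolding deriv_of_def using R by (rule module_hom.scale)
  moreover have "Vector_Spaces.linear (cscale act) (poly_cscale act) (\<lambda>p. f (R p) q)" for q
    using Vector_Spaces.linear_compose[OF module_hom_imp_linear_cscale[OF R]] f
    unfolding conformal_sesquilinear_def comp_def by blast
  ultimately show ?thesis
    using f by (simp add: conformal_sesquilinear_def)
qed

lemma conformal_sesquilinear_precompose_right:
  assumes f: "conformal_sesquilinear act f" and R: "module_hom act act R"
  shows "conformal_sesquilinear act (\<lambda>p q. f p (R q))"
proof -
  have "R (deriv_of act p) = deriv_of act (R p)" for p
    unfolding deriv_of_def using R by (rule module_hom.scale)
  moreover have "Vector_Spaces.linear (cscale act) (poly_cscale act) (\<lambda>q. f p (R q))" for p
    using Vector_Spaces.linear_compose[OF module_hom_imp_linear_cscale[OF R]] f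
    unfolding conformal_sesquilinear_def comp_def by blast
  ultimately show ?thesis
    using f by (simp add: conformal_sesquilinear_def)
qed

lemma conformal_sesquilinear_poly_cscale:
  assumes f: "conformal_sesquilinear act f" and act: "module act"
  shows "conformal_sesquilinear act (\<lambda>p q. poly_cscale act c (f p q))"
proof -
  note c = cscale_zero[OF act] cscale_add[OF act]
  have lin: "Vector_Spaces.linear (cscale act) (poly_cscale act) (\<lambda>x. poly_cscale act c (g x))"
    if g: "Vector_Spaces.linear (cscale act) (poly_cscale act) g" for g
  proof -
    interpret V: vector_space "poly_cscale act"
      using g by (simp add: Vector_Spaces.linear_iff)
    show ?thesis
      using Vector_Spaces.linear_compose[OF g V.linear_scale_self[of c]] by (simp add: comp_def)
  qed
  have "poly_cscale act c (- pCons 0 P) = - pCons 0 (poly_cscale act c P)" for P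
    by (rule poly_eqI)
       (simp add: poly_cscale_def coeff_map_poly coeff_pCons c cscale_def
          module.scale_minus_right[OF act] module.scale_zero_right[OF act] split: nat.split)
  moreover have "poly_cscale act c (map_poly (deriv_of act) P + pCons 0 P) =
      map_poly (deriv_of act) (poly_cscale act c P) + pCons 0 (poly_cscale act c P)" for P
    by (rule poly_eqI)
       (simp add: poly_cscale_def coeff_map_poly coeff_pCons c deriv_of_zero[OF act]
          cscale_deriv_of[OF act] split: nat.split)
  ultimately show ?thesis
    using f lin by (simp add: conformal_sesquilinear_def)
qed

lemma multiplicative_poly_cscale:
  assumes f: "multiplicative f \<alpha>" and act: "module act"
    and \<alpha>: "Vector_Spaces.linear (cscale act) (cscale act) \<alpha>"
  shows "multiplicative (\<lambda>p q. poly_cscale act c (f p q)) \<alpha>"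
proof -
  have "map_poly \<alpha> (poly_cscale act c P) = poly_cscale act c (map_poly \<alpha> P)" for P
    using \<alpha> linear_zero[OF \<alpha>] cscale_zero[OF act]
    by (intro poly_eqI)
       (simp add: poly_cscale_def coeff_map_poly Vector_Spaces.linear_iff)
  then show ?thesis
    using f by (simp add: multiplicative_def)
qed

section \<open>Scalars and iterated products\<close>

lemma prod_left_poly_cscale_value:
  assumes "module act"
  shows "prod_left (\<lambda>p q. poly_cscale act c (f p q)) P r =
    map_poly (poly_cscale act c) (prod_left f P r)"
  unfolding poly_cscale_def
  by (rule prod_left_map_poly_value) (simp_all add: cscale_zero cscale_add assms)

lemma prod_right_poly_cscale_value:
  assumes "module act" and "conformal_sesquilinear act f"
  shows "prod_right (\<lambda>p q. poly_cscale act c (f p q)) p Q =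
    map_poly (poly_cscale act c) (prod_right f p Q)"
  unfolding poly_cscale_def
  by (rule prod_right_map_poly_value)
     (simp_all add: cscale_zero conformal_sesquilinear_zero[OF assms(2)] assms(1))

text \<open>By bilinearity a scalar on the coefficients of the polynomial argument equals the same scalar
  on the values of the product.\<close>

lemma prod_left_poly_cscale:
  assumes act: "module act" and f: "conformal_sesquilinear act f"
  shows "prod_left f (poly_cscale act c P) r = map_poly (poly_cscale act c) (prod_left f P r)"
proof -
  have "f (cscale act c p) q = poly_cscale act c (f p q)" for p q
    using f by (simp add: conformal_sesquilinear_def Vector_Spaces.linear_iff)
  moreover have "prod_left f (poly_cscale act c P) r = prod_left (\<lambda>p q. f (cscale act c p) q) P r"
    unfolding poly_cscale_def
    by (rule prod_left_map_poly) (simp_all add: cscale_zero act conformal_sesquilinear_zero[OF f])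
  ultimately show ?thesis
    by (simp add: prod_left_poly_cscale_value[OF act])
qed

lemma prod_right_poly_cscale:
  assumes act: "module act" and f: "conformal_sesquilinear act f"
  shows "prod_right f p (poly_cscale act c Q) = map_poly (poly_cscale act c) (prod_right f p Q)"
proof -
  have "f p (cscale act c q) = poly_cscale act c (f p q)" for p q
    using f by (simp add: conformal_sesquilinear_def Vector_Spaces.linear_iff)
  moreover have "prod_right f p (poly_cscale act c Q) = prod_right (\<lambda>p q. f p (cscale act c q)) p Q"
    unfolding poly_cscale_def
    by (rule prod_right_map_poly) (simp_all add: cscale_zero act conformal_sesquilinear_zero[OF f])
  ultimately show ?thesis
    by (simp add: prod_right_poly_cscale_value[OF act f])
qed

section \<open>The tridendriform structure of a Rota-Baxter operator\<close>

theorem proposition3p3: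
  fixes act :: "complex poly \<Rightarrow> 'a::ab_group_add \<Rightarrow> 'a"
    and \<tau> :: "'a \<Rightarrow> 'a \<Rightarrow> 'a poly"
    and \<alpha> \<beta> R :: "'a \<Rightarrow> 'a"
    and \<theta> :: complex
  assumes "bihom_assoc_conformal_algebra act \<tau> \<alpha> \<beta>"
    and "rota_baxter_operator act \<tau> \<theta> R"
    and "\<And>p. R (\<alpha> p) = \<alpha> (R p)"
    and "\<And>p. R (\<beta> p) = \<beta> (R p)"
  shows "bihom_tridendriform_conformal_algebra act
    (\<lambda>p q. \<tau> p (R q))
    (\<lambda>p q. \<tau> (R p) q)
    (\<lambda>p q. poly_cscale act \<theta> (\<tau> p q))
    \<alpha> \<beta>"
proof -
  interpret bihom_assoc_conformal_algebra act \<tau> \<alpha> \<beta> by fact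
  have R: "module_hom act act R"
    and baxter: "\<tau> (R p) (R q) =
      map_poly R (\<tau> (R p) q + \<tau> p (R q) + poly_cscale act \<theta> (\<tau> p q))" for p q
    using assms(2) by (auto simp: rota_baxter_operator_def)
  note R\<alpha> = assms(3) and R\<beta> = assms(4)
  have R0: "R 0 = 0"
    using R by (rule module_hom.zero)
  have baxter': "map_poly R (\<tau> p (R q) + \<tau> (R p) q + poly_cscale act \<theta> (\<tau> p q)) = \<tau> (R p) (R q)"
    for p q
    by (simp add: baxter add.commute)
  note left_R = prod_left_map_poly[where h = R and f = \<tau>, OF R0
      conformal_sesquilinear_zero(1)[OF sesquilinear], symmetric]
  note right_R = prod_right_map_poly[where h = R and f = \<tau>, OF R0
      conformal_sesquilinear_zero(2)[OF sesquilinear], symmetric]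
  \<comment> \<open>An \<open>R\<close> on an outer argument passes through the twist; an \<open>R\<close> on an inner argument is already
    inside the polynomial.\<close>
  have twist_left: "prod_right (\<lambda>p. \<tau> (R p)) (\<alpha> p) Q = prod_right \<tau> (\<alpha> (R p)) Q" for p Q
    by (simp add: prod_right_def R\<alpha>)
  have twist_right: "prod_left (\<lambda>p q. \<tau> p (R q)) P (\<beta> r) = prod_left \<tau> P (\<beta> (R r))" for P r
    by (simp add: prod_left_def R\<beta>)
  note scalars = prod_left_poly_cscale[OF module_axioms sesquilinear]
    prod_right_poly_cscale[OF module_axioms sesquilinear]
    prod_left_poly_cscale_value[OF module_axioms]
    prod_right_poly_cscale_value[OF module_axioms sesquilinear]
  show ?thesis
  proof (unfold_locales, goal_cases)
    case 1 show ?case by (rule conformal_sesquilinear_precompose_right[OF sesquilinear R])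
  next
    case 2 show ?case by (rule conformal_sesquilinear_precompose_left[OF sesquilinear R])
  next
    case 3 show ?case by (rule conformal_sesquilinear_poly_cscale[OF sesquilinear module_axioms])
  next
    case 4 show ?case using mult_alpha by (simp add: multiplicative_def R\<alpha>)
  next
    case 5 show ?case using mult_alpha by (simp add: multiplicative_def R\<alpha>)
  next
    case 6 show ?case by (rule multiplicative_poly_cscale[OF mult_alpha module_axioms linear_alpha])
  next
    case 7 show ?case using mult_beta by (simp add: multiplicative_def R\<beta>)
  next
    case 8 show ?case using mult_beta by (simp add: multiplicative_def R\<beta>)
  next
    case 9 show ?case by (rule multiplicative_poly_cscale[OF mult_beta module_axioms linear_beta])
  next
    \<comment> \<open>\<open>R\<close> is on \<open>q\<close> and \<open>r\<close>, so the Rota-Baxter relation is used for the inner product \<open>q\<^sub>\<mu> r\<close>.\<close>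
    case 10 show ?case by (simp add: twist_right right_R baxter' bihom_assoc)
  next
    \<comment> \<open>\<open>R\<close> is on \<open>p\<close> and \<open>r\<close>, which are not multiplied with each other.\<close>
    case 11 show ?case by (simp add: twist_right twist_left bihom_assoc)
  next
    \<comment> \<open>\<open>R\<close> is on \<open>p\<close> and \<open>q\<close>, so the Rota-Baxter relation is used for the inner product \<open>p\<^sub>\<lambda> q\<close>.\<close>
    case 12 show ?case by (simp add: twist_left left_R baxter' bihom_assoc)
  next
    \<comment> \<open>\<open>R\<close> is on \<open>q\<close> only, and both sides carry one factor \<open>\<theta>\<close>.\<close>
    case 13 show ?case by (simp add: scalars bihom_assoc)
  next
    \<comment> \<open>\<open>R\<close> is on \<open>p\<close> only; on the left \<open>\<theta>\<close> comes from the inner product, on the right from the outer.\<close>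
    case 14 show ?case by (simp add: scalars twist_left bihom_assoc)
  next
    \<comment> \<open>\<open>R\<close> is on \<open>r\<close> only; on the left \<open>\<theta>\<close> comes from the outer product, on the right from the inner.\<close>
    case 15 show ?case by (simp add: scalars twist_right bihom_assoc)
  next
    case 16 show ?case by (simp add: scalars bihom_assoc)
  qed
qed

end
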